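(* Let $\mathcal A$ be a non-trivial well-founded $\Sigma$-algebra (i.e. there exist $a,b$ in its carrier with $a\not\geq b$), let $\sigma$ be the empty partial status and let $\succsim$ be the quasi-precedence $\Sigma\times\Sigma$ (all symbols equivalent). Then $(\geq_{\mathcal A},>_{\mathcal A})=(\succsim_{\mathrm{WPO}},\succ_{\mathrm{WPO}})$, where the WPO pair is the refined one (including clauses (2c) and (2d)).
   Context: Terms over a finite signature $\Sigma$ and variables $\mathcal V$. Well-founded $\Sigma$-algebra $\mathcal A=(A,\geq,>,(f_{\mathcal A}))$: quasi-order $\geq$, well-founded strict order $>$ with ${\geq}\circ{>}\circ{\geq}\subseteq{>}$, $f_{\mathcal A}:A^n\to A$. On terms, $s\geq_{\mathcal A}t$ (resp. $>_{\mathcal A}$) iff $\hat\alpha(s)\geq\hat\alpha(t)$ (resp. $>$) for all $\alpha:\mathcal V\to A$. A partial status $\sigma$ assigns to each $f\in\Sigma_n$ a list of distinct positions in $\{1..n\}$ (also viewed as a set); $\sigma(f)(s_1..s_n)$ is the list of the $s_i$ at those positions in that order; the empty status has $\sigma(f)=[\,]$ for all $f$. $\mathcal A$ is strictly (weakly) simple w.r.t. $\sigma$ iff $f_{\mathcal A}(\dots,a_i,\dots)>a_i$ ($\geq a_i$) for all $f$ and $i\in\sigma(f)$. Quasi-precedence: quasi-order $\succsim$ on $\Sigma$ with well-founded strict part $\succ$, equivalence $\sim$. For a pair $(\succsim',\succ')$: $[s_1..s_n]\succsim'^{\mathrm{lex}}[t_1..t_m]$ iff there is $k\le n$ with $s_i\succsim'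 t_i$ for $i\le k$ and either $k=m$, or $k<\min(n,m)$ and $s_{k+1}\succ' t_{k+1}$; $\succ'^{\mathrm{lex}}$ is the same but in the case $k=m$ additionally $k<n$. WPO pair (refined): relations $\succsim_W,\succ_W$ defined simultaneously by recursion: $x\succsim_W x$ for variables $x$; for $s=f(s_1..s_n)$, $s\succsim_W t$ (resp. $s\succ_W t$) iff (1) $s>_{\mathcal A}t$, or (2) $s\ge_{\mathcal A}t$ and (a) $s_i\succsim_W t$ for some $i\in\sigma(f)$, or (b) $t=g(t_1..t_m)$, $s\succ_W t_j$ for all $j\in\sigma(g)$, and either $f\succ g$, or $f\sim g$ and $\sigma(f)(\vec s)\succsim_W^{\mathrm{lex}}\sigma(g)(\vec t)$ (resp. $\succ_W^{\mathrm{lex}}$). Moreover $s\succsim_W t$ also holds if $s\ge_{\mathcal A}t$ and (2c) $s\in\mathcal V$, $t=g(t_1..t_m)$, $\sigma(g)=[\,]$ and $f\succsim g$ for every $f\in\Sigma$; or (2d) (this clause is included only when $\mathcal A$ is strictly simple w.r.t. $\sigma$) $s=f(s_1..s_n)$, $t\in\mathcal V$, and for every $g\in\Sigma$, $f\succ g$ or ($f\succsim g$ and $\sigma(g)=[\,]$). Nothing else is related.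
   Formalization: The formal statement additionally assumes that > is contained in ≥ on the carrier; without it the claim fails, e.g. for carrier {T,F}, ≥ the identity, > = {(T,F)} and constants T, F, where clause (1) gives T ≿_WPO F but not T ≥_A F. *)

theory Defs
  imports Main
begin

datatype ('f, 'v) trm = Var 'v | Fun 'f "('f, 'v) trm list"

text \<open>A signature is given by its set of symbols \<open>Sig\<close> and an arity function \<open>ar\<close>,
  which is only relevant on \<open>Sig\<close>.\<close>

inductive_set trms :: "'f set \<Rightarrow> ('f \<Rightarrow> nat) \<Rightarrow> ('f, 'v) trm set"
  for Sig :: "'f set" and ar :: "'f \<Rightarrow> nat" where
  "Var x \<in> trms Sig ar"
| "f \<in> Sig \<Longrightarrow> length ts = ar f \<Longrightarrow> (\<And>t. t \<in> set ts \<Longrightarrow> t \<in> trms Sig ar) \<Longrightarrow>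
     Fun f ts \<in> trms Sig ar"

text \<open>In the relations \<open>geq\<close> and \<open>gt\<close> a pair \<open>(a, b)\<close> means that \<open>a\<close> is the
  greater element.\<close>

record ('f, 'a) algebra =
  carrier :: "'a set"
  geq :: "('a \<times> 'a) set"
  gt :: "('a \<times> 'a) set"
  interp :: "'f \<Rightarrow> 'a list \<Rightarrow> 'a"

definition wf_algebra :: "'f set \<Rightarrow> ('f \<Rightarrow> nat) \<Rightarrow> ('f, 'a) algebra \<Rightarrow> bool" where
  "wf_algebra Sig ar \<A> \<longleftrightarrow>
     preorder_on (carrier \<A>) (geq \<A>) \<and>
     gt \<A> \<subseteq> carrier \<A> \<times> carrier \<A> \<and> irrefl (gt \<A>) \<and> trans (gt \<A>) \<and> wf ((gt \<A>)\<inverse>) \<and>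
     geq \<A> O gt \<A> O geq \<A> \<subseteq> gt \<A> \<and>
     (\<forall>f\<in>Sig. \<forall>as. length as = ar f \<and> set as \<subseteq> carrier \<A> \<longrightarrow> interp \<A> f as \<in> carrier \<A>)"

definition nontrivial :: "('f, 'a) algebra \<Rightarrow> bool" where
  "nontrivial \<A> \<longleftrightarrow> (\<exists>a\<in>carrier \<A>. \<exists>b\<in>carrier \<A>. (a, b) \<notin> geq \<A>)"

fun eval :: "('f, 'a) algebra \<Rightarrow> ('v \<Rightarrow> 'a) \<Rightarrow> ('f, 'v) trm \<Rightarrow> 'a" where
  "eval \<A> \<alpha> (Var x) = \<alpha> x"
| "eval \<A> \<alpha> (Fun f ts) = interp \<A> f (map (eval \<A> \<alpha>) ts)"

definition trm_geq ::
  "'f set \<Rightarrow> ('f \<Rightarrow> nat) \<Rightarrow> ('f, 'a) algebra \<Rightarrow> ('f, 'v) trm \<Rightarrow> ('f, 'v) trm \<Rightarrow> bool" where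
  "trm_geq Sig ar \<A> s t \<longleftrightarrow> s \<in> trms Sig ar \<and> t \<in> trms Sig ar \<and>
     (\<forall>\<alpha>. range \<alpha> \<subseteq> carrier \<A> \<longrightarrow> (eval \<A> \<alpha> s, eval \<A> \<alpha> t) \<in> geq \<A>)"

definition trm_gt ::
  "'f set \<Rightarrow> ('f \<Rightarrow> nat) \<Rightarrow> ('f, 'a) algebra \<Rightarrow> ('f, 'v) trm \<Rightarrow> ('f, 'v) trm \<Rightarrow> bool" where
  "trm_gt Sig ar \<A> s t \<longleftrightarrow> s \<in> trms Sig ar \<and> t \<in> trms Sig ar \<and>
     (\<forall>\<alpha>. range \<alpha> \<subseteq> carrier \<A> \<longrightarrow> (eval \<A> \<alpha> s, eval \<A> \<alpha> t) \<in> gt \<A>)"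

text \<open>Positions are counted from 1.\<close>

definition partial_status :: "'f set \<Rightarrow> ('f \<Rightarrow> nat) \<Rightarrow> ('f \<Rightarrow> nat list) \<Rightarrow> bool" where
  "partial_status Sig ar \<sigma> \<longleftrightarrow> (\<forall>f\<in>Sig. distinct (\<sigma> f) \<and> set (\<sigma> f) \<subseteq> {1..ar f})"

definition empty_status :: "'f \<Rightarrow> nat list" where
  "empty_status f = []"

abbreviation arg :: "'b list \<Rightarrow> nat \<Rightarrow> 'b" where
  "arg xs i \<equiv> xs ! (i - 1)"

definition args_at :: "nat list \<Rightarrow> 'b list \<Rightarrow> 'b list" where
  "args_at ps xs = map (arg xs) ps"

definition strictly_simple ::
  "'f set \<Rightarrow> ('f \<Rightarrow> nat) \<Rightarrow> ('f, 'a) algebra \<Rightarrow> ('f \<Rightarrow> nat list) \<Rightarrow> bool" where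
  "strictly_simple Sig ar \<A> \<sigma> \<longleftrightarrow>
     (\<forall>f\<in>Sig. \<forall>i\<in>set (\<sigma> f). \<forall>as. length as = ar f \<and> set as \<subseteq> carrier \<A> \<longrightarrow>
        (interp \<A> f as, arg as i) \<in> gt \<A>)"

definition strict_part :: "('f \<times> 'f) set \<Rightarrow> ('f \<times> 'f) set" where
  "strict_part r = r - r\<inverse>"

definition equiv_part :: "('f \<times> 'f) set \<Rightarrow> ('f \<times> 'f) set" where
  "equiv_part r = r \<inter> r\<inverse>"

definition quasi_precedence :: "'f set \<Rightarrow> ('f \<times> 'f) set \<Rightarrow> bool" where
  "quasi_precedence Sig prec \<longleftrightarrow> preorder_on Sig prec \<and> wf ((strict_part prec)\<inverse>)"

definition lex_weak ::
  "('t \<Rightarrow> 't \<Rightarrow> bool) \<Rightarrow> ('t \<Rightarrow> 't \<Rightarrow> bool) \<Rightarrow> 't list \<Rightarrow> 't list \<Rightarrow> bool" where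
  "lex_weak W S ss ts \<longleftrightarrow> (\<exists>k\<le>length ss. (\<forall>i<k. W (ss ! i) (ts ! i)) \<and>
     (k = length ts \<or> k < min (length ss) (length ts) \<and> S (ss ! k) (ts ! k)))"

definition lex_strict ::
  "('t \<Rightarrow> 't \<Rightarrow> bool) \<Rightarrow> ('t \<Rightarrow> 't \<Rightarrow> bool) \<Rightarrow> 't list \<Rightarrow> 't list \<Rightarrow> bool" where
  "lex_strict W S ss ts \<longleftrightarrow> (\<exists>k\<le>length ss. (\<forall>i<k. W (ss ! i) (ts ! i)) \<and>
     (k = length ts \<and> k < length ss \<or> k < min (length ss) (length ts) \<and> S (ss ! k) (ts ! k)))"

lemma lex_weak_mono [mono]:
  assumes "\<And>x y. W x y \<longrightarrow> W' x y" and "\<And>x y. S x y \<longrightarrow> S' x y"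
  shows "lex_weak W S ss ts \<longrightarrow> lex_weak W' S' ss ts"
  unfolding lex_weak_def by (intro impI, elim exE, rule exI) (use assms in auto)

lemma lex_strict_mono [mono]:
  assumes "\<And>x y. W x y \<longrightarrow> W' x y" and "\<And>x y. S x y \<longrightarrow> S' x y"
  shows "lex_strict W S ss ts \<longrightarrow> lex_strict W' S' ss ts"
  unfolding lex_strict_def by (intro impI, elim exE, rule exI) (use assms in auto)

text \<open>The rules are those of the recursive definition of the refined weighted path order. Every
  premise compares a pair of terms of smaller total size (for valid statuses), so the least pair
  of relations closed under them is the one defined by recursion.\<close>

inductive
  wpo_weak :: "'f set \<Rightarrow> ('f \<Rightarrow> nat) \<Rightarrow> ('f, 'a) algebra \<Rightarrow> ('f \<Rightarrow> nat list) \<Rightarrow> ('f \<times> 'f) set \<Rightarrow>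
    ('f, 'v) trm \<Rightarrow> ('f, 'v) trm \<Rightarrow> bool" and
  wpo_strict :: "'f set \<Rightarrow> ('f \<Rightarrow> nat) \<Rightarrow> ('f, 'a) algebra \<Rightarrow> ('f \<Rightarrow> nat list) \<Rightarrow> ('f \<times> 'f) set \<Rightarrow>
    ('f, 'v) trm \<Rightarrow> ('f, 'v) trm \<Rightarrow> bool"
  for Sig :: "'f set" and ar :: "'f \<Rightarrow> nat" and \<A> :: "('f, 'a) algebra"
    and \<sigma> :: "'f \<Rightarrow> nat list" and prec :: "('f \<times> 'f) set"
where
  weak_var: "wpo_weak Sig ar \<A> \<sigma> prec (Var x) (Var x)"
| weak_1: "trm_gt Sig ar \<A> (Fun f ss) t \<Longrightarrow> wpo_weak Sig ar \<A> \<sigma> prec (Fun f ss) t"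
| weak_2a: "\<lbrakk>trm_geq Sig ar \<A> (Fun f ss) t;
    i \<in> set (\<sigma> f); wpo_weak Sig ar \<A> \<sigma> prec (arg ss i) t\<rbrakk> \<Longrightarrow>
    wpo_weak Sig ar \<A> \<sigma> prec (Fun f ss) t"
| weak_2b: "\<lbrakk>trm_geq Sig ar \<A> (Fun f ss) (Fun g ts);
    \<forall>j\<in>set (\<sigma> g). wpo_strict Sig ar \<A> \<sigma> prec (Fun f ss) (arg ts j);
    (f, g) \<in> strict_part prec \<or>
    (f, g) \<in> equiv_part prec \<and>
      lex_weak (wpo_weak Sig ar \<A> \<sigma> prec) (wpo_strict Sig ar \<A> \<sigma> prec)
        (args_at (\<sigma> f) ss) (args_at (\<sigma> g) ts)\<rbrakk> \<Longrightarrow>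
    wpo_weak Sig ar \<A> \<sigma> prec (Fun f ss) (Fun g ts)"
| weak_2c: "\<lbrakk>trm_geq Sig ar \<A> (Var x) (Fun g ts);
    \<sigma> g = []; \<forall>f\<in>Sig. (f, g) \<in> prec\<rbrakk> \<Longrightarrow>
    wpo_weak Sig ar \<A> \<sigma> prec (Var x) (Fun g ts)"
| weak_2d: "\<lbrakk>strictly_simple Sig ar \<A> \<sigma>; trm_geq Sig ar \<A> (Fun f ss) (Var x);
    \<forall>g\<in>Sig. (f, g) \<in> strict_part prec \<or> (f, g) \<in> prec \<and> \<sigma> g = []\<rbrakk> \<Longrightarrow>
    wpo_weak Sig ar \<A> \<sigma> prec (Fun f ss) (Var x)"
| strict_1: "trm_gt Sig ar \<A> (Fun f ss) t \<Longrightarrow> wpo_strict Sig ar \<A> \<sigma> prec (Fun f ss) t"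
| strict_2a: "\<lbrakk>trm_geq Sig ar \<A> (Fun f ss) t;
    i \<in> set (\<sigma> f); wpo_weak Sig ar \<A> \<sigma> prec (arg ss i) t\<rbrakk> \<Longrightarrow>
    wpo_strict Sig ar \<A> \<sigma> prec (Fun f ss) t"
| strict_2b: "\<lbrakk>trm_geq Sig ar \<A> (Fun f ss) (Fun g ts);
    \<forall>j\<in>set (\<sigma> g). wpo_strict Sig ar \<A> \<sigma> prec (Fun f ss) (arg ts j);
    (f, g) \<in> strict_part prec \<or>
    (f, g) \<in> equiv_part prec \<and>
      lex_strict (wpo_weak Sig ar \<A> \<sigma> prec) (wpo_strict Sig ar \<A> \<sigma> prec)
        (args_at (\<sigma> f) ss) (args_at (\<sigma> g) ts)\<rbrakk> \<Longrightarrow>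
    wpo_strict Sig ar \<A> \<sigma> prec (Fun f ss) (Fun g ts)"

lemma partial_status_empty: "partial_status Sig ar empty_status"
  by (simp add: partial_status_def empty_status_def)

lemma quasi_precedence_full: "quasi_precedence Sig (Sig \<times> Sig)"
proof -
  have "strict_part (Sig \<times> Sig) = {}"
    by (auto simp: strict_part_def)
  then show ?thesis
    by (auto simp: quasi_precedence_def preorder_on_def refl_on_def intro: transI)
qed

end

theory Submission
  imports Defs
begin

text \<open>With the empty status and a single equivalence class of symbols, every condition on
  arguments is vacuous, so the weak clauses amount to \<open>\<ge>\<close> and the strict ones to \<open>>\<close>.
  Clause (1) is available only for terms with a root symbol, which loses nothing: a variable is
  never strictly above a term, because it may be assigned a minimal element. Distinct variables
  are not weakly comparable, by non-triviality.\<close>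

lemma Fun_in_trmsD: "Fun f ts \<in> trms Sig ar \<Longrightarrow> f \<in> Sig"
  by (auto elim: trms.cases)

lemma trm_geqD:
  assumes "trm_geq Sig ar \<A> s t" "range \<alpha> \<subseteq> carrier \<A>"
  shows "(eval \<A> \<alpha> s, eval \<A> \<alpha> t) \<in> geq \<A>"
  using assms by (simp add: trm_geq_def)

lemma trm_gt_imp_geq:
  assumes "gt \<A> \<subseteq> geq \<A>" "trm_gt Sig ar \<A> s t"
  shows "trm_geq Sig ar \<A> s t"
  using assms unfolding trm_gt_def trm_geq_def by blast

lemma trm_geq_Var_refl:
  assumes "wf_algebra Sig ar \<A>"
  shows "trm_geq Sig ar \<A> (Var x) (Var x)"
  using assms
  by (auto simp: trm_geq_def wf_algebra_def preorder_on_def refl_on_def image_subset_iff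
      intro: trms.intros)

lemma not_trm_gt_Var:
  assumes "wf_algebra Sig ar \<A>" "carrier \<A> \<noteq> {}"
  shows "\<not> trm_gt Sig ar \<A> (Var x) t"
proof
  assume gt: "trm_gt Sig ar \<A> (Var x) t"
  have wf: "wf ((gt \<A>)\<inverse>)"
    using assms(1) by (simp add: wf_algebra_def)
  obtain a where a: "a \<in> carrier \<A>" and min: "\<And>b. (b, a) \<in> (gt \<A>)\<inverse> \<Longrightarrow> b \<notin> carrier \<A>"
    using assms(2) wfE_min'[OF wf] by metis
  \<comment> \<open>The constant assignment gives the variable the minimal value \<open>a\<close>;
    the value of \<open>t\<close> would then be a carrier element below \<open>a\<close>.\<close>
  have "(a, eval \<A> (\<lambda>_. a) t) \<in> gt \<A>"
    using gt a by (auto simp: trm_gt_def)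
  moreover have "gt \<A> \<subseteq> carrier \<A> \<times> carrier \<A>"
    using assms(1) by (simp add: wf_algebra_def)
  ultimately show False
    using min by blast
qed

lemma trm_geq_VarsD:
  assumes "nontrivial \<A>" "trm_geq Sig ar \<A> (Var x) (Var y)"
  shows "x = y"
proof (rule ccontr)
  assume "x \<noteq> y"
  obtain a b where ab: "a \<in> carrier \<A>" "b \<in> carrier \<A>" "(a, b) \<notin> geq \<A>"
    using assms(1) by (auto simp: nontrivial_def)
  \<comment> \<open>Since \<open>y\<close> differs from \<open>x\<close>, this assignment evaluates
    the two sides to the incomparable pair \<open>(a, b)\<close>.\<close>
  have "range (\<lambda>z. if z = x then a else b) \<subseteq> carrier \<A>"
    using ab by auto
  from trm_geqD[OF assms(2) this] show False
    using ab \<open>x \<noteq> y\<close> by simp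
qed

text \<open>One case analysis suffices, without induction: each clause has the algebraic comparison
  as its own premise, except reflexivity on variables and clause (1), where the inclusion of
  \<open>gt\<close> in \<open>geq\<close> is used.\<close>

lemma wpo_weak_empty_status_imp_trm_geq:
  assumes "wf_algebra Sig ar \<A>" "gt \<A> \<subseteq> geq \<A>" "wpo_weak Sig ar \<A> empty_status prec s t"
  shows "trm_geq Sig ar \<A> s t"
  using assms(3)
  by cases (auto intro: trm_geq_Var_refl[OF assms(1)] trm_gt_imp_geq[OF assms(2)])

text \<open>The kinds of the two roots select the clause: reflexivity for two variables, (2c) for a
  variable on the left only, (2d) for one on the right only, (2b) for two symbols.\<close>

lemma trm_geq_imp_wpo_weak_empty_status:
  assumes "nontrivial \<A>" "trm_geq Sig ar \<A> s t"
  shows "wpo_weak Sig ar \<A> empty_status (Sig \<times> Sig) s t"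
proof -
  have st: "s \<in> trms Sig ar" "t \<in> trms Sig ar"
    using assms(2) by (auto simp: trm_geq_def)
  show ?thesis
  proof (cases s)
    case s: (Var x)
    show ?thesis
    proof (cases t)
      case (Var y)
      then show ?thesis
        using trm_geq_VarsD assms s by (metis weak_var)
    next
      case (Fun g ts)
      then show ?thesis
        using assms(2) st s
        by (auto intro!: weak_2c simp: empty_status_def dest: Fun_in_trmsD)
    qed
  next
    case s: (Fun f ss)
    show ?thesis
    proof (cases t)
      \<comment> \<open>Strict simplicity, the guard of (2d), is vacuous as no position is
        selected.\<close>
      case (Var y)
      then show ?thesis
        using assms(2) st s
        by (auto intro!: weak_2d simp: empty_status_def strictly_simple_def dest: Fun_in_trmsD)
    next
      \<comment> \<open>Both selected lists are empty, so \<open>lex_weak\<close> holds with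
        \<open>k = 0\<close>.\<close>
      case (Fun g ts)
      then show ?thesis
        using assms(2) st s
        by (auto intro!: weak_2b dest: Fun_in_trmsD
            simp: empty_status_def equiv_part_def args_at_def lex_weak_def)
    qed
  qed
qed

text \<open>Only clause (1) survives: (2a) has no position to choose, and (2b) fails because the
  full relation has empty strict part and \<open>lex_strict\<close> on two empty lists would need
  \<open>k < 0\<close>.\<close>

lemma wpo_strict_empty_status_imp_trm_gt:
  assumes "wpo_strict Sig ar \<A> empty_status (Sig \<times> Sig) s t"
  shows "trm_gt Sig ar \<A> s t"
  using assms
  by cases (auto simp: empty_status_def strict_part_def args_at_def lex_strict_def)

lemma trm_gt_imp_wpo_strict:
  assumes "wf_algebra Sig ar \<A>" "carrier \<A> \<noteq> {}" "trm_gt Sig ar \<A> s t"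
  shows "wpo_strict Sig ar \<A> \<sigma> prec s t"
  using assms(3) by (cases s) (auto intro: strict_1 dest: not_trm_gt_Var[OF assms(1,2), THEN notE])

theorem theorem21:
  fixes Sig :: "'f set" and ar :: "'f \<Rightarrow> nat" and \<A> :: "('f, 'a) algebra"
  assumes "finite Sig"
    and "wf_algebra Sig ar \<A>"
    and "gt \<A> \<subseteq> geq \<A>"
    and "nontrivial \<A>"
  shows "(trm_geq Sig ar \<A> :: ('f, 'v) trm \<Rightarrow> ('f, 'v) trm \<Rightarrow> bool,
      trm_gt Sig ar \<A> :: ('f, 'v) trm \<Rightarrow> ('f, 'v) trm \<Rightarrow> bool) =
    (wpo_weak Sig ar \<A> empty_status (Sig \<times> Sig), wpo_strict Sig ar \<A> empty_status (Sig \<times> Sig))"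
proof -
  have ne: "carrier \<A> \<noteq> {}"
    using assms(4) by (auto simp: nontrivial_def)
  show ?thesis
    unfolding prod.inject
    by (intro conjI ext iffI)
      (fact trm_geq_imp_wpo_weak_empty_status[OF assms(4)]
        wpo_weak_empty_status_imp_trm_geq[OF assms(2,3)]
        trm_gt_imp_wpo_strict[OF assms(2) ne]
        wpo_strict_empty_status_imp_trm_gt)+
qed

end
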